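(* Let $k\ge 0$ and let $S$ be a $k$-stacked homology $d$-sphere. For every integer $e$ with $k\le e\le d-k-1$, $S$ does not have any standard $e$-sphere as an induced subcomplex. In consequence, $S$ does not admit any bistellar move of index $i$ for $k+1\le i\le d-k$.
   Context: Simplicial complexes are finite and contain the empty set as a face. For a finite set $\alpha$, $\overline{\alpha}$ is the complex of all subsets of $\alpha$, $\partial\alpha$ the complex of all proper subsets, and $\dim(\alpha)=\#(\alpha)-1$; $\ast$ denotes join. A standard $e$-sphere $S^e_{e+2}$ is the boundary complex $\partial\alpha$ of an $(e+1)$-simplex ($\#(\alpha)=e+2$). Bistellar moves: a $d$-dimensional complex $X$ admits the bistellar move $\alpha\mapsto\beta$, of index $\dim(\beta)$, if $\alpha,\beta$ are disjoint non-empty finite sets with $\dim(\alpha)+\dim(\beta)=d$ such that the induced subcomplex of $X$ on $\alpha\sqcup\beta$ is $\overline{\alpha}\ast\partial\beta$ (the move replaces $\overline{\alpha}\ast\partial\beta$ by $\partial\alpha\ast\overline{\beta}$; if $\beta$ is a single vertex, $\beta$ is a new vertex not in $X$). A homology sphere/ball means an $\mathbb{F}$-homology sphere/ball for some field $\mathbb{F}$. An $\mathbb{F}$-homology $d$-sphere is a $d$-dimensional complex in which the link of every face $\sigma$ (including $\emptyset$) has the reduced $\mathbb{F}$-homology of a $(d-\dim(\sigma)-1)$-sphere. An $\mathbb{F}$-homology $d$-ball is a $d$-dimensional $\mathbb{F}$-acyclic complex in which the link of every non-empty face $\sigma$ has the reduced homology of a $(d-\dim(\sigma)-1)$-sphere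 or of a point, and whose faces with acyclic link form an $\mathbb{F}$-homology $(d-1)$-sphere (its boundary). A homology $(d+1)$-ball is $k$-stacked if all its faces of codimension at least $k+1$ (dimension $\le d-k$) lie in its boundary; a homology $d$-sphere is $k$-stacked if it is the boundary of a $k$-stacked homology $(d+1)$-ball. *)

theory Defs
  imports Complex_Main "HOL-Library.Function_Algebras"
begin

type_synonym 'v complex = "'v set set"

definition simplicial_complex :: "'v complex \<Rightarrow> bool" where
  "simplicial_complex X \<longleftrightarrow>
     finite X \<and> (\<forall>\<sigma>\<in>X. finite \<sigma>) \<and> {} \<in> X \<and> (\<forall>\<sigma>\<in>X. \<forall>\<tau>. \<tau> \<subseteq> \<sigma> \<longrightarrow> \<tau> \<in> X)"

definition vertices :: "'v complex \<Rightarrow> 'v set" where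
  "vertices X = \<Union>X"

text \<open>Dimensions are integers, so that the empty face has dimension \<open>-1\<close>.\<close>

definition face_dim :: "'v set \<Rightarrow> int" where
  "face_dim \<sigma> = int (card \<sigma>) - 1"

definition complex_dim :: "'v complex \<Rightarrow> int" where
  "complex_dim X = Max (face_dim ` X)"

definition full_simplex :: "'v set \<Rightarrow> 'v complex" where
  "full_simplex \<alpha> = {\<sigma>. \<sigma> \<subseteq> \<alpha>}"

definition simplex_boundary :: "'v set \<Rightarrow> 'v complex" where
  "simplex_boundary \<alpha> = {\<sigma>. \<sigma> \<subset> \<alpha>}"

text \<open>Only applied to complexes on disjoint vertex sets.\<close>

definition join :: "'v complex \<Rightarrow> 'v complex \<Rightarrow> 'v complex" where
  "join X Y = {\<sigma> \<union> \<tau> | \<sigma> \<tau>. \<sigma> \<in> X \<and> \<tau> \<in> Y}"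

definition link :: "'v complex \<Rightarrow> 'v set \<Rightarrow> 'v complex" where
  "link X \<sigma> = {\<tau>. \<tau> \<inter> \<sigma> = {} \<and> \<tau> \<union> \<sigma> \<in> X}"

definition induced :: "'v complex \<Rightarrow> 'v set \<Rightarrow> 'v complex" where
  "induced X W = {\<sigma> \<in> X. \<sigma> \<subseteq> W}"

definition standard_sphere :: "int \<Rightarrow> 'v complex \<Rightarrow> bool" where
  "standard_sphere e X \<longleftrightarrow>
     (\<exists>\<alpha>. finite \<alpha> \<and> int (card \<alpha>) = e + 2 \<and> X = simplex_boundary \<alpha>)"

section \<open>Reduced simplicial homology over a field\<close>

text \<open>
  Simplices are oriented by one fixed linear order on the type of all vertices; it is chosen
  arbitrarily so that no order has to be assumed on that type. Homology does not depend on it.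
\<close>

definition vertex_order :: "'v rel" where
  "vertex_order = (SOME r. linear_order r)"

lemma linear_order_vertex_order: "linear_order (vertex_order :: 'v rel)"
proof -
  obtain r :: "'v rel" where "well_order r"
    using well_order_on by blast
  then have "linear_order r"
    by (simp add: well_order_on_def)
  then show ?thesis
    unfolding vertex_order_def by (rule someI)
qed

definition vertex_less :: "'v \<Rightarrow> 'v \<Rightarrow> bool" where
  "vertex_less u v \<longleftrightarrow> u \<noteq> v \<and> (u, v) \<in> vertex_order"

text \<open>
  A chain is its coefficient function on faces. The empty face is a generator in degree \<open>-1\<close>,
  which makes the homology reduced.
\<close>

definition chains :: "'v complex \<Rightarrow> int \<Rightarrow> ('v set \<Rightarrow> 'f::field) set" where
  "chains X i = {c. \<forall>\<sigma>. c \<sigma> \<noteq> 0 \<longrightarrow> \<sigma> \<in> X \<and> face_dim \<sigma> = i}"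

text \<open>
  The usual boundary
  \<open>[v\<^sub>0, \<dots>, v\<^sub>i] \<mapsto> \<Sum>j\<le>i. (-1) ^ j * [v\<^sub>0, \<dots>, v\<^sub>j\<^sub>-\<^sub>1, v\<^sub>j\<^sub>+\<^sub>1, \<dots>, v\<^sub>i]\<close> for
  increasing \<open>v\<^sub>0, \<dots>, v\<^sub>i\<close>, written by coefficients: \<open>\<tau>\<close> arises from \<open>insert v \<tau>\<close> by deleting
  \<open>v\<close>, whose position is the number of elements of \<open>\<tau>\<close> below \<open>v\<close>.
\<close>

definition chain_boundary ::
    "'v complex \<Rightarrow> ('v set \<Rightarrow> 'f::field) \<Rightarrow> ('v set \<Rightarrow> 'f)" where
  "chain_boundary X c =
     (\<lambda>\<tau>. \<Sum>v \<in> vertices X - \<tau>. (- 1) ^ card {u \<in> \<tau>. vertex_less u v} * c (insert v \<tau>))"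

definition cycles :: "'v complex \<Rightarrow> int \<Rightarrow> ('v set \<Rightarrow> 'f::field) set" where
  "cycles X i = {c \<in> chains X i. chain_boundary X c = (\<lambda>\<sigma>. 0)}"

definition boundaries :: "'v complex \<Rightarrow> int \<Rightarrow> ('v set \<Rightarrow> 'f::field) set" where
  "boundaries X i = chain_boundary X ` chains X (i + 1)"

definition chain_scale :: "'f::field \<Rightarrow> ('v set \<Rightarrow> 'f) \<Rightarrow> ('v set \<Rightarrow> 'f)" where
  "chain_scale a c = (\<lambda>\<sigma>. a * c \<sigma>)"

interpretation chain: vector_space "chain_scale :: 'f::field \<Rightarrow> ('v set \<Rightarrow> 'f) \<Rightarrow> ('v set \<Rightarrow> 'f)"
  by unfold_locales (auto simp: chain_scale_def fun_eq_iff algebra_simps)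

text \<open>
  The dimension of the reduced homology \<open>cycles X i / boundaries X i\<close>. For a finite complex
  both spaces are finite-dimensional and the boundaries are among the cycles. The coefficient
  field is passed as a type.
\<close>

definition reduced_betti :: "'f::field itself \<Rightarrow> 'v complex \<Rightarrow> int \<Rightarrow> nat" where
  "reduced_betti F X i =
     chain.dim (cycles X i :: ('v set \<Rightarrow> 'f) set) - chain.dim (boundaries X i :: ('v set \<Rightarrow> 'f) set)"

text \<open>Here \<open>m = -1\<close> is allowed: the \<open>(-1)\<close>-sphere is the complex \<open>{{}}\<close>.\<close>

definition sphere_homology :: "'f::field itself \<Rightarrow> int \<Rightarrow> 'v complex \<Rightarrow> bool" where
  "sphere_homology F m X \<longleftrightarrow> (\<forall>i. reduced_betti F X i = (if i = m then 1 else 0))"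

text \<open>Equivalently, \<open>X\<close> has the reduced homology of a point.\<close>

definition acyclic_complex :: "'f::field itself \<Rightarrow> 'v complex \<Rightarrow> bool" where
  "acyclic_complex F X \<longleftrightarrow> (\<forall>i. reduced_betti F X i = 0)"

section \<open>Homology spheres and balls, stackedness\<close>

definition homology_sphere :: "'f::field itself \<Rightarrow> int \<Rightarrow> 'v complex \<Rightarrow> bool" where
  "homology_sphere F d X \<longleftrightarrow>
     simplicial_complex X \<and> complex_dim X = d \<and>
     (\<forall>\<sigma>\<in>X. sphere_homology F (d - face_dim \<sigma> - 1) (link X \<sigma>))"

definition ball_boundary :: "'f::field itself \<Rightarrow> 'v complex \<Rightarrow> 'v complex" where
  "ball_boundary F X = {\<sigma> \<in> X. acyclic_complex F (link X \<sigma>)}"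

definition homology_ball :: "'f::field itself \<Rightarrow> int \<Rightarrow> 'v complex \<Rightarrow> bool" where
  "homology_ball F d X \<longleftrightarrow>
     simplicial_complex X \<and> complex_dim X = d \<and> acyclic_complex F X \<and>
     (\<forall>\<sigma>\<in>X. \<sigma> \<noteq> {} \<longrightarrow>
        sphere_homology F (d - face_dim \<sigma> - 1) (link X \<sigma>) \<or> acyclic_complex F (link X \<sigma>)) \<and>
     homology_sphere F (d - 1) (ball_boundary F X)"

definition stacked_ball :: "'f::field itself \<Rightarrow> int \<Rightarrow> int \<Rightarrow> 'v complex \<Rightarrow> bool" where
  "stacked_ball F k D B \<longleftrightarrow>
     homology_ball F D B \<and> (\<forall>\<sigma>\<in>B. D - face_dim \<sigma> \<ge> k + 1 \<longrightarrow> \<sigma> \<in> ball_boundary F B)"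

definition stacked_sphere :: "'f::field itself \<Rightarrow> int \<Rightarrow> int \<Rightarrow> 'v complex \<Rightarrow> bool" where
  "stacked_sphere F k d S \<longleftrightarrow>
     homology_sphere F d S \<and> (\<exists>B. stacked_ball F k (d + 1) B \<and> S = ball_boundary F B)"

section \<open>Bistellar moves\<close>

text \<open>
  If \<open>\<beta> = {x}\<close>, then \<open>simplex_boundary \<beta> = {{}}\<close> and the last condition already says that \<open>x\<close>
  is not a vertex of \<open>X\<close>.
\<close>

definition admits_bistellar_move :: "'v complex \<Rightarrow> 'v set \<Rightarrow> 'v set \<Rightarrow> bool" where
  "admits_bistellar_move X \<alpha> \<beta> \<longleftrightarrow>
     finite \<alpha> \<and> finite \<beta> \<and> \<alpha> \<noteq> {} \<and> \<beta> \<noteq> {} \<and> \<alpha> \<inter> \<beta> = {} \<and>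
     face_dim \<alpha> + face_dim \<beta> = complex_dim X \<and>
     induced X (\<alpha> \<union> \<beta>) = join (full_simplex \<alpha>) (simplex_boundary \<beta>)"

definition bistellar_index :: "'v set \<Rightarrow> 'v set \<Rightarrow> int" where
  "bistellar_index \<alpha> \<beta> = face_dim \<beta>"

end

(* A missing face \<alpha> of S with k + 2 \<le> card \<alpha> \<le> d - k + 1 is also missing in the ball B, since B and S
   have the same faces of dimension at most d - k. Delete the vertices of \<alpha> one at a time.
   In B, all proper faces of \<alpha> lie in the boundary and have acyclic links, so every step preserves
   acyclicity and the complement of \<alpha> in B is acyclic. In S, the complement of every proper nonempty
   face of \<alpha> is acyclic, and the last step moves the fundamental class of the link of a face into
   degree d - card \<alpha> + 1 of the complement of \<alpha>. In that degree the two complements have the same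
   cycles and boundaries, a contradiction. *)

theory Submission
  imports Defs
begin

text \<open>The argument is Alexander duality unrolled into the exact sequence of the pair
  \<open>X\<close>, \<open>X - v\<close>, whose relative homology in degree \<open>i + 1\<close> is
  that of the link of \<open>v\<close> in degree \<open>i\<close>. Only the segment
  \<open>H_{i+1}(X) -> H_i(link v) -> H_i(X - v) -> H_i(X)\<close> is used, chased on chains. The
  obstacle is a sphere minus one vertex: neither the sphere nor the link is acyclic, so the top
  class of the sphere must map onto that of the link. This needs a nonzero top cycle to have a
  nonzero contraction at every vertex, which rests on the connectedness of spheres of positive
  dimension. The two bounds on \<open>card \<alpha>\<close> have separate purposes. The upper one
  makes \<open>\<alpha>\<close> small enough to be missing in \<open>B\<close> as well; the lower
  one keeps the fillings, which live in dimension \<open>d - card \<alpha> + 2\<close>, within the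
  common faces of \<open>B\<close> and \<open>S\<close>.\<close>

section \<open>Contraction and cone operators\<close>

text \<open>As simplification rules, the pointwise laws eta-expand sums of chains.\<close>

declare plus_fun_apply [simp del] zero_fun_apply [simp del]
  minus_apply [simp del] uminus_apply [simp del]

lemmas pointwise = fun_eq_iff plus_fun_apply zero_fun_apply minus_apply uminus_apply

lemma vertex_less_asym: "vertex_less u v \<Longrightarrow> \<not> vertex_less v u"
  using linear_order_vertex_order[where ?'v='a]
  unfolding vertex_less_def linear_order_on_def partial_order_on_def antisym_def by blast

lemma vertex_less_total: "u \<noteq> v \<Longrightarrow> vertex_less u v \<or> vertex_less v u"
  using linear_order_vertex_order[where ?'v='a]
  unfolding vertex_less_def linear_order_on_def total_on_def by blast

definition vertex_sign :: "'v \<Rightarrow> 'v set \<Rightarrow> 'f::field" where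
  "vertex_sign v \<tau> = (- 1) ^ card {u \<in> \<tau>. vertex_less u v}"

lemma vertex_sign_square [simp]: "vertex_sign v \<tau> * vertex_sign v \<tau> = (1::'f::field)"
  by (simp add: vertex_sign_def flip: power_mult_distrib)

lemma vertex_sign_nonzero [simp]: "vertex_sign v \<tau> \<noteq> (0::'f::field)"
  by (simp add: vertex_sign_def)

lemma vertex_sign_empty [simp]: "vertex_sign v {} = 1"
  by (simp add: vertex_sign_def)

lemma vertex_sign_insert:
  assumes "finite \<tau>" "u \<notin> \<tau>"
  shows "vertex_sign v (insert u \<tau>) =
    (if vertex_less u v then - vertex_sign v \<tau> else (vertex_sign v \<tau> :: 'f::field))"
proof -
  have "{x \<in> insert u \<tau>. vertex_less x v} =
    (if vertex_less u v then insert u {x \<in> \<tau>. vertex_less x v} else {x \<in> \<tau>. vertex_less x v})"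
    by auto
  then show ?thesis
    using assms by (simp add: vertex_sign_def)
qed

lemma vertex_sign_insert_self [simp]: "vertex_sign v (insert v \<tau>) = vertex_sign v \<tau>"
proof -
  have "{x \<in> insert v \<tau>. vertex_less x v} = {x \<in> \<tau>. vertex_less x v}"
    by (auto simp: vertex_less_def)
  then show ?thesis by (simp add: vertex_sign_def)
qed

lemma vertex_sign_Diff_self [simp]: "vertex_sign v (\<tau> - {v}) = vertex_sign v \<tau>"
  by (metis insert_Diff_single vertex_sign_insert_self)

text \<open>The interior product of exterior algebra, with \<open>cone\<close> as exterior
  multiplication by \<open>v\<close>. The guard \<open>finite \<tau>\<close> discards sets on which
  counting predecessors gives no usable sign, so the identities below hold for arbitrary coefficient
  functions.\<close>

definition contract :: "'v \<Rightarrow> ('v set \<Rightarrow> 'f::field) \<Rightarrow> 'v set \<Rightarrow> 'f" where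
  "contract v c = (\<lambda>\<tau>. if finite \<tau> \<and> v \<notin> \<tau> then vertex_sign v \<tau> * c (insert v \<tau>) else 0)"

definition cone :: "'v \<Rightarrow> ('v set \<Rightarrow> 'f::field) \<Rightarrow> 'v set \<Rightarrow> 'f" where
  "cone v c = (\<lambda>\<tau>. if finite \<tau> \<and> v \<in> \<tau> then vertex_sign v \<tau> * c (\<tau> - {v}) else 0)"

text \<open>A boundary that depends on a vertex set but on no complex: with one \<open>V\<close>, a
  complex, its links and its deletions share the same operator.\<close>

definition bd :: "'v set \<Rightarrow> ('v set \<Rightarrow> 'f::field) \<Rightarrow> 'v set \<Rightarrow> 'f" where
  "bd V c = (\<Sum>v\<in>V. contract v c)"

lemma sum_fun_apply: "(\<Sum>v\<in>V. f v) x = (\<Sum>v\<in>V. f v x)"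
  by (induction V rule: infinite_finite_induct) (simp_all add: pointwise)

lemma contract_add: "contract v (a + b) = contract v a + contract v b"
  and contract_diff: "contract v (a - b) = contract v a - contract v b"
  and contract_zero [simp]: "contract v 0 = 0"
  and contract_scale: "contract v (chain_scale r a) = chain_scale r (contract v a)"
  by (auto simp: contract_def pointwise algebra_simps chain_scale_def)

lemma cone_add: "cone v (a + b) = cone v a + cone v b"
  and cone_zero [simp]: "cone v 0 = 0"
  by (auto simp: cone_def pointwise algebra_simps)

lemma contract_sum: "contract v (\<Sum>x\<in>A. f x) = (\<Sum>x\<in>A. contract v (f x))"
  by (induction A rule: infinite_finite_induct) (simp_all add: contract_add)

lemma cone_sum: "cone v (\<Sum>x\<in>A. f x) = (\<Sum>x\<in>A. cone v (f x))"
  by (induction A rule: infinite_finite_induct) (auto simp: cone_add)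

lemma bd_add: "bd V (a + b) = bd V a + bd V b"
  and bd_diff: "bd V (a - b) = bd V a - bd V b"
  and bd_zero [simp]: "bd V 0 = 0"
  by (simp_all add: bd_def contract_add contract_diff sum.distrib sum_subtractf)

lemma chain_scale_sum: "chain_scale r (\<Sum>x\<in>A. f x) = (\<Sum>x\<in>A. chain_scale r (f x))"
  by (induction A rule: infinite_finite_induct) (auto simp: chain.scale_right_distrib)

lemma bd_scale: "bd V (chain_scale r a) = chain_scale r (bd V a)"
  by (simp add: bd_def contract_scale chain_scale_sum)

lemma contract_self [simp]: "contract v (contract v c) = 0"
  by (auto simp: contract_def pointwise)

text \<open>Exactly one of \<open>u\<close>, \<open>v\<close> precedes the other, so exactly one of
  the two orders of removal picks up an extra sign.\<close>

lemma contract_anticommute: "contract u (contract v c) = - contract v (contract u c)"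
proof (cases "u = v")
  case False
  have "contract u (contract v c) \<tau> = - contract v (contract u c) \<tau>"
 for \<tau>
    using False vertex_less_total[OF False] vertex_less_asym[of u v]
    by (auto simp: contract_def vertex_sign_insert insert_commute)
  then show ?thesis by (simp add: pointwise)
qed simp

lemma contract_bd: "contract u (bd V c) = - bd V (contract u c)"
proof -
  have "contract u (bd V c) = (\<Sum>v\<in>V. - contract v (contract u c))"
    unfolding bd_def contract_sum by (rule sum.cong[OF refl]) (rule contract_anticommute)
  then show ?thesis by (simp add: bd_def sum_negf)
qed

text \<open>The square of a sum of anticommuting operators of square zero is zero.\<close>

lemma bd_bd:
  fixes c :: "'v set \<Rightarrow> 'f::field"
  shows "bd V (bd V c) = 0"
proof (induction V rule: infinite_finite_induct)
  case (insert x V)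
  have "bd (insert x V) a = contract x a + bd V a" for a :: "'v set \<Rightarrow> 'f"
    using insert by (simp add: bd_def)
  then show ?case
    using insert.IH by (simp add: contract_add bd_add contract_bd)
qed (simp_all add: bd_def)

lemma contract_cone:
  fixes c :: "'v set \<Rightarrow> 'f::field"
  assumes "u \<noteq> v"
  shows "contract u (cone v c) = - cone v (contract u c)"
proof -
  have *: "insert u \<tau> - {v} = insert u (\<tau> - {v})" for \<tau> using assms by auto
  have **: "vertex_sign u \<tau> = (if vertex_less v u then - vertex_sign u (\<tau> - {v})
      else (vertex_sign u (\<tau> - {v}) :: 'f))" if "v \<in> \<tau>" "finite \<tau>" for \<tau>
    using vertex_sign_insert[of "\<tau> - {v}" v u] that by (simp add: insert_absorb)
  have "contract u (cone v c) \<tau> = - cone v (contract u c) \<tau>" for \<tau>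
    using assms vertex_less_total[OF assms] vertex_less_asym[of u v]
    by (auto simp: contract_def cone_def vertex_sign_insert * **)
  then show ?thesis by (simp add: pointwise)
qed

definition avoiding :: "'v \<Rightarrow> ('v set \<Rightarrow> 'f::field) set" where
  "avoiding v = {c. \<forall>\<sigma>. c \<sigma> \<noteq> 0 \<longrightarrow> finite \<sigma> \<and> v \<notin> \<sigma>}"

lemma contract_avoiding [simp]: "c \<in> avoiding v \<Longrightarrow> contract v c = 0"
  by (force simp: contract_def avoiding_def pointwise)

lemma contract_cone_self: "c \<in> avoiding v \<Longrightarrow> contract v (cone v c) = c"
  by (force simp: contract_def cone_def avoiding_def pointwise mult.assoc[symmetric])

text \<open>The Cartan formula: coning with \<open>v\<close> is a contracting homotopy.\<close>

lemma bd_cone: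
  fixes c :: "'v set \<Rightarrow> 'f::field"
  assumes "finite V" "v \<in> V" "c \<in> avoiding v"
  shows "bd V (cone v c) = c - cone v (bd V c)"
proof -
  have split: "bd V a = contract v a + bd (V - {v}) a" for a :: "'v set \<Rightarrow> 'f"
    using assms by (simp add: bd_def sum.remove)
  have "bd (V - {v}) (cone v c) = (\<Sum>u\<in>V - {v}. - cone v (contract u c))"
    unfolding bd_def by (rule sum.cong) (auto simp: contract_cone)
  also have "\<dots> = - cone v (bd (V - {v}) c)"
    by (simp add: bd_def cone_sum sum_negf)
  finally show ?thesis
    using assms(3) by (simp add: split contract_cone_self)
qed

section \<open>Chains of a complex, its links and its vertex deletions\<close>

text \<open>The empty face is not demanded, because the link of a nonface is the void complex and
  the inductions have to pass through such links.\<close>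

definition face_closed :: "'v complex \<Rightarrow> bool" where
  "face_closed X \<longleftrightarrow> finite X \<and> (\<forall>\<sigma>\<in>X. finite \<sigma> \<and> (\<forall>\<tau>\<subseteq>\<sigma>. \<tau> \<in> X))"

lemma face_closed_simplicial: "simplicial_complex X \<longleftrightarrow> face_closed X \<and> {} \<in> X"
  unfolding simplicial_complex_def face_closed_def by auto

lemma face_closed_subset: "face_closed X \<Longrightarrow> \<sigma> \<in> X \<Longrightarrow> \<tau> \<subseteq> \<sigma> \<Longrightarrow> \<tau> \<in> X"
  unfolding face_closed_def by blast

lemma face_closed_finite: "face_closed X \<Longrightarrow> \<sigma> \<in> X \<Longrightarrow> finite \<sigma>"
  unfolding face_closed_def by blast

lemma finite_vertices: "face_closed X \<Longrightarrow> finite (vertices X)"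
  unfolding face_closed_def vertices_def by blast

lemma face_closed_induced: "face_closed X \<Longrightarrow> face_closed (induced X W)"
  unfolding face_closed_def induced_def by auto

lemma link_subset: "face_closed X \<Longrightarrow> link X \<sigma> \<subseteq> X"
  unfolding link_def face_closed_def by blast

lemma face_closed_link:
  assumes "face_closed X"
  shows "face_closed (link X \<sigma>)"
  unfolding face_closed_def
proof (intro conjI ballI allI impI)
  show "finite (link X \<sigma>)"
    using assms link_subset finite_subset unfolding face_closed_def by metis
  fix \<rho> assume \<rho>: "\<rho> \<in> link X \<sigma>"
  show "finite \<rho>"
    using assms \<rho> link_subset face_closed_finite by blast
  fix \<tau> assume "\<tau> \<subseteq> \<rho>"
  then show "\<tau> \<in> link X \<sigma>"
    using \<rho> face_closed_subset[OF assms, of "\<rho> \<union> \<sigma>" "\<tau> \<union> \<sigma>"] by (auto simp: link_def)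
qed

lemma link_empty [simp]: "link X {} = X"
  by (simp add: link_def)

lemma link_nonface: "face_closed X \<Longrightarrow> \<sigma> \<notin> X \<Longrightarrow> link X \<sigma> = {}"
  unfolding link_def using face_closed_subset by fastforce

lemma link_link: "\<sigma> \<inter> \<tau> = {} \<Longrightarrow> link (link X \<sigma>) \<tau> = link X (\<sigma> \<union> \<tau>)"
  by (auto simp: link_def ac_simps)

lemma vertices_mono: "X \<subseteq> Y \<Longrightarrow> vertices X \<subseteq> vertices Y"
  unfolding vertices_def by blast

lemma induced_subset: "induced X W \<subseteq> X"
  by (auto simp: induced_def)

lemma induced_Compl_insert: "induced X (- insert v A) = induced (induced X (- A)) (- {v})"
  by (auto simp: induced_def)

lemma link_induced_Compl:
  "v \<notin> A \<Longrightarrow> link (induced X (- A)) {v} = induced (link X {v}) (- A)"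
  by (auto simp: induced_def link_def)

lemma chains_mono: "X \<subseteq> Y \<Longrightarrow> chains X i \<subseteq> chains Y i"
  by (auto simp: chains_def)

lemma chains_zero [simp]: "0 \<in> chains X i"
  and chains_add: "a \<in> chains X i \<Longrightarrow> b \<in> chains X i \<Longrightarrow> a + b \<in> chains X i"
  and chains_diff: "a \<in> chains X i \<Longrightarrow> b \<in> chains X i \<Longrightarrow> a - b \<in> chains X i"
  and chains_scale: "a \<in> chains X i \<Longrightarrow> chain_scale r a \<in> chains X i"
  unfolding chains_def chain_scale_def pointwise
  by simp (simp, metis add_0, simp, metis diff_0_right diff_0, simp)

lemma face_dim_insert: "finite \<tau> \<Longrightarrow> v \<notin> \<tau> \<Longrightarrow> face_dim (insert v \<tau>) = face_dim \<tau> + 1"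
  by (simp add: face_dim_def)

text \<open>A vertex \<open>v\<close> outside \<open>X\<close> contributes nothing, since a nonzero
  coefficient at \<open>insert v \<tau>\<close> would make that set a face.\<close>

lemma chain_boundary_eq_bd:
  assumes X: "face_closed X" and V: "finite V" "vertices X \<subseteq> V" and c: "c \<in> chains X i"
  shows "chain_boundary X c = bd V c"
proof
  fix \<tau>
  have cX: "insert v \<tau> \<in> X" if "c (insert v \<tau>) \<noteq> 0" for v
    using c that by (auto simp: chains_def)
  show "chain_boundary X c \<tau> = bd V c \<tau>"
  proof (cases "finite \<tau>")
    case True
    have "bd V c \<tau> = (\<Sum>v\<in>V. contract v c \<tau>)"
      by (simp add: bd_def sum_fun_apply)
    also have "\<dots> = (\<Sum>v\<in>vertices X - \<tau>. contract v c \<tau>)"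
      using V cX by (intro sum.mono_neutral_right) (auto simp: contract_def vertices_def)
    also have "\<dots> = chain_boundary X c \<tau>"
      unfolding chain_boundary_def using True
      by (intro sum.cong) (auto simp: contract_def vertex_sign_def)
    finally show ?thesis ..
  next
    case False
    then have "c (insert v \<tau>) = 0" for v
      using cX X face_closed_finite by fastforce
    then show ?thesis
      using False by (simp add: chain_boundary_def bd_def sum_fun_apply contract_def)
  qed
qed

lemma contract_chain:
  assumes "face_closed X" "c \<in> chains X i"
  shows "contract v c \<in> chains (link X {v}) (i - 1)"
  using assms by (auto simp: chains_def contract_def link_def face_dim_insert split: if_splits)

lemma bd_chain:
  assumes "face_closed X" "c \<in> chains X i"
  shows "bd V c \<in> chains X (i - 1)"
proof -
  have "contract v c \<in> chains X (i - 1)" for v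
    using contract_chain[OF assms] chains_mono[OF link_subset[OF assms(1)]] by blast
  then show ?thesis
    unfolding bd_def by (induction V rule: infinite_finite_induct) (auto intro: chains_add)
qed

lemma chain_avoiding:
  "face_closed X \<Longrightarrow> c \<in> chains X i \<Longrightarrow> v \<notin> vertices X \<Longrightarrow> c \<in> avoiding v"
  by (auto simp: chains_def avoiding_def vertices_def face_closed_def)

lemma vertex_notin_link: "v \<notin> vertices (link X {v})"
  by (auto simp: vertices_def link_def)

lemma vertex_notin_deletion: "v \<notin> vertices (induced X (- {v}))"
  by (auto simp: vertices_def induced_def)

lemma link_subset_deletion: "face_closed X \<Longrightarrow> link X {v} \<subseteq> induced X (- {v})"
  using link_subset[of X "{v}"] by (auto simp: induced_def link_def)

lemma cone_chain:
  assumes "face_closed X" "b \<in> chains (link X {v}) i"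
  shows "cone v b \<in> chains X (i + 1)"
proof -
  have "\<sigma> \<in> X \<and> face_dim \<sigma> = i + 1"
    if "finite \<sigma>" "v \<in> \<sigma>" "b (\<sigma> - {v}) \<noteq> 0" for \<sigma>
  proof -
    have "\<sigma> - {v} \<in> link X {v}" "face_dim (\<sigma> - {v}) = i"
      using assms(2) that(3) unfolding chains_def by blast+
    then show ?thesis
      using that face_dim_insert[of "\<sigma> - {v}" v] by (auto simp: link_def insert_absorb)
  qed
  then show ?thesis
    by (auto simp: chains_def cone_def split: if_splits)
qed

text \<open>The signs of \<open>cone\<close> and \<open>contract\<close> cancel, so their composite
  restricts \<open>c\<close> to the faces containing \<open>v\<close>; what remains lives on the
  deletion.\<close>

lemma decompose_chain:
  assumes "face_closed X" "c \<in> chains X i"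
  obtains a where "a \<in> chains (induced X (- {v})) i" "c = a + cone v (contract v c)"
proof
  have fin: "finite \<sigma>" if "c \<sigma> \<noteq> 0" for \<sigma>
    using assms that face_closed_finite by (auto simp: chains_def)
  have cc: "cone v (contract v c) = (\<lambda>\<sigma>. if v \<in> \<sigma> then c \<sigma> else 0)"
    using fin by (force simp: cone_def contract_def insert_absorb mult.assoc[symmetric])
  show "c - cone v (contract v c) \<in> chains (induced X (- {v})) i"
    using assms by (auto simp: cc chains_def induced_def minus_apply split: if_splits)
qed simp

lemma cycles_iff:
  assumes "face_closed X" "finite V" "vertices X \<subseteq> V"
  shows "z \<in> cycles X i \<longleftrightarrow> z \<in> chains X i \<and> bd V z = 0"
  using chain_boundary_eq_bd[OF assms, of z i] by (auto simp: cycles_def simp flip: zero_fun_def)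

lemma boundaries_iff:
  assumes "face_closed X" "finite V" "vertices X \<subseteq> V"
  shows "z \<in> boundaries X i \<longleftrightarrow> (\<exists>c\<in>chains X (i + 1). z = bd V c)"
  using chain_boundary_eq_bd[OF assms] by (auto simp: boundaries_def)

lemma boundaries_subset_cycles:
  assumes "face_closed X"
  shows "boundaries X i \<subseteq> (cycles X i :: ('v set \<Rightarrow> 'f::field) set)"
proof
  fix z :: "'v set \<Rightarrow> 'f" assume "z \<in> boundaries X i"
  then obtain c where c: "c \<in> chains X (i + 1)" "z = bd (vertices X) c"
    using boundaries_iff[OF assms finite_vertices[OF assms] order_refl] by auto
  then show "z \<in> cycles X i"
    using bd_chain[OF assms c(1), of "vertices X"]
    by (simp add: cycles_iff[OF assms finite_vertices[OF assms] order_refl] bd_bd)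
qed

lemma cycles_mono:
  assumes "face_closed X" "face_closed Y" "X \<subseteq> Y"
  shows "cycles X i \<subseteq> cycles Y i"
  using cycles_iff[OF assms(1) finite_vertices[OF assms(2)] vertices_mono[OF assms(3)]]
    cycles_iff[OF assms(2) finite_vertices[OF assms(2)] order_refl] chains_mono[OF assms(3)]
  by blast

text \<open>On homology this is the map to the relative group of the pair \<open>X\<close>,
  \<open>X - v\<close>, identified with the homology of the link one degree lower.\<close>

lemma contract_cycle:
  assumes X: "face_closed X" and z: "z \<in> cycles X i"
  shows "contract v z \<in> cycles (link X {v}) (i - 1)"
proof -
  note V = finite_vertices[OF X]
  have "z \<in> chains X i" "bd (vertices X) z = 0"
    using z cycles_iff[OF X V order_refl] by auto
  moreover from this have "bd (vertices X) (contract v z) = 0"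
    using contract_bd[of v "vertices X" z] by simp
  ultimately show ?thesis
    using contract_chain[OF X]
      cycles_iff[OF face_closed_link[OF X] V vertices_mono[OF link_subset[OF X]]] by blast
qed

section \<open>Betti numbers and exactness\<close>

text \<open>Vanishing homology as an inclusion, which suits arguments on representatives better than
  a difference of dimensions.\<close>

definition exact_at :: "'f::field itself \<Rightarrow> 'v complex \<Rightarrow> int \<Rightarrow> bool" where
  "exact_at F X i \<longleftrightarrow> (cycles X i :: ('v set \<Rightarrow> 'f) set) \<subseteq> boundaries X i"

lemma subspace_cycles:
  assumes X: "face_closed X"
  shows "chain.subspace (cycles X i :: ('v set \<Rightarrow> 'f::field) set)"
  by (auto simp: chain.subspace_def cycles_iff[OF X finite_vertices[OF X] order_refl]
      bd_add bd_scale intro: chains_add chains_scale)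

lemma subspace_boundaries:
  assumes X: "face_closed X"
  shows "chain.subspace (boundaries X i :: ('v set \<Rightarrow> 'f::field) set)"
proof (rule chain.subspaceI)
  note iff = boundaries_iff[OF X finite_vertices[OF X] order_refl]
  show "(0 :: 'v set \<Rightarrow> 'f) \<in> boundaries X i"
    unfolding iff by (rule bexI[of _ 0]) simp_all
  show "a + b \<in> boundaries X i" if "a \<in> boundaries X i" "b \<in> boundaries X i" for a b :: "'v set \<Rightarrow> 'f"
    using that unfolding iff by (metis bd_add chains_add)
  show "chain_scale r a \<in> boundaries X i" if "a \<in> boundaries X i" for r and a :: "'v set \<Rightarrow> 'f"
    using that unfolding iff by (metis bd_scale chains_scale)
qed

lemma finite_spanning_cycles:
  assumes X: "face_closed X"
  obtains T :: "('v set \<Rightarrow> 'f::field) set" where "finite T" "cycles X i \<subseteq> chain.span T"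
proof
  define e where "e \<sigma> = (\<lambda>\<tau>. if \<tau> = \<sigma> then 1 else 0 :: 'f)" for \<sigma> :: "'v set"
  have finX: "finite X" using X by (simp add: face_closed_def)
  then show "finite (e ` X)" by simp
  show "cycles X i \<subseteq> chain.span (e ` X)"
  proof
    fix z :: "'v set \<Rightarrow> 'f" assume "z \<in> cycles X i"
    then have "z \<sigma> = 0" if "\<sigma> \<notin> X" for \<sigma>
      using that by (auto simp: cycles_def chains_def)
    then have "z = (\<Sum>\<sigma>\<in>X. chain_scale (z \<sigma>) (e \<sigma>))"
      using finX by (auto simp: pointwise sum_fun_apply chain_scale_def e_def if_distrib cong: if_cong)
    also have "\<dots> \<in> chain.span (e ` X)"
      by (intro chain.span_sum chain.span_scale chain.span_base) auto
    finally show "z \<in> chain.span (e ` X)" .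
  qed
qed

lemma finite_basis_cycles:
  assumes X: "face_closed X"
  obtains T :: "('v set \<Rightarrow> 'f::field) set" where "finite T" "T \<subseteq> cycles X i"
    "chain.independent T" "cycles X i \<subseteq> chain.span T" "card T = chain.dim (cycles X i :: ('v set \<Rightarrow> 'f) set)"
proof -
  obtain T :: "('v set \<Rightarrow> 'f) set" where T: "T \<subseteq> cycles X i" "chain.independent T"
    "cycles X i \<subseteq> chain.span T" "card T = chain.dim (cycles X i :: ('v set \<Rightarrow> 'f) set)"
    using chain.basis_exists by blast
  obtain G :: "('v set \<Rightarrow> 'f) set" where "finite G" "cycles X i \<subseteq> chain.span G"
    using finite_spanning_cycles[OF X] by blast
  then have "finite T"
    using chain.independent_span_bound[of G T] T by blast
  then show ?thesis using T that by blast
qed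

text \<open>The Betti number is a truncated difference, so its vanishing only bounds the dimension
  of the cycles by that of the boundaries. A cycle that bounds nothing would enlarge a basis of the
  boundaries and, by finiteness, make the difference positive.\<close>

lemma exact_at_if_betti_zero:
  fixes X :: "'v complex"
  assumes X: "face_closed X" and betti: "reduced_betti (F :: 'f::field itself) X i = 0"
  shows "exact_at F X i"
  unfolding exact_at_def
proof (rule ccontr)
  let ?Z = "cycles X i :: ('v set \<Rightarrow> 'f) set" and ?B = "boundaries X i :: ('v set \<Rightarrow> 'f) set"
  assume "\<not> ?Z \<subseteq> ?B"
  then obtain z where z: "z \<in> ?Z" "z \<notin> ?B" by blast
  obtain T where T: "finite T" "?Z \<subseteq> chain.span T" "card T = chain.dim ?Z"
    using finite_basis_cycles[OF X] by metis
  obtain U where U: "U \<subseteq> ?B" "chain.independent U" "?B \<subseteq> chain.span U" "card U = chain.dim ?B"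
    using chain.basis_exists by blast
  have "chain.span U = ?B"
    using U subspace_boundaries[OF X] chain.span_minimal by blast
  then have "z \<notin> chain.span U" using z by simp
  then have ind: "chain.independent (insert z U)" "z \<notin> U"
    using U(2) by (auto simp: chain.independent_insert intro: chain.span_base)
  have "insert z U \<subseteq> chain.span T"
    using z U(1) boundaries_subset_cycles[OF X] T(2) by blast
  then have "finite (insert z U)" "card (insert z U) \<le> card T"
    using chain.independent_span_bound[OF T(1) ind(1)] by auto
  then have "chain.dim ?B < chain.dim ?Z"
    using ind(2) T(3) U(4) by simp
  then show False
    using betti by (simp add: reduced_betti_def)
qed

text \<open>A fundamental cycle. In the top degree all boundaries vanish, so one-dimensional
  homology is a one-dimensional space of cycles.\<close>

definition generates_cycles :: "('v set \<Rightarrow> 'f::field) \<Rightarrow> 'v complex \<Rightarrow> int \<Rightarrow> bool" where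
  "generates_cycles z X i \<longleftrightarrow>
     z \<in> cycles X i \<and> z \<noteq> 0 \<and> (\<forall>y\<in>cycles X i. \<exists>r. y = chain_scale r z)"

lemma boundaries_top:
  assumes "\<forall>\<sigma>\<in>X. face_dim \<sigma> \<le> i"
  shows "boundaries X i = {0 :: 'v set \<Rightarrow> 'f::field}"
proof -
  have "chains X (i + 1) = {0 :: 'v set \<Rightarrow> 'f}"
    using assms by (fastforce simp: chains_def pointwise)
  moreover have "chain_boundary X 0 = (0 :: 'v set \<Rightarrow> 'f)"
    by (simp add: chain_boundary_def pointwise)
  ultimately show ?thesis
    by (simp add: boundaries_def)
qed

lemma generates_cycles_if_betti_one:
  assumes X: "face_closed X" and top: "\<forall>\<sigma>\<in>X. face_dim \<sigma> \<le> i"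
    and betti: "reduced_betti TYPE('f) X i = 1"
  obtains z :: "'v set \<Rightarrow> 'f::field" where "generates_cycles z X i"
proof -
  obtain T :: "('v set \<Rightarrow> 'f) set" where T: "finite T" "T \<subseteq> cycles X i" "chain.independent T"
    "cycles X i \<subseteq> chain.span T" "card T = chain.dim (cycles X i :: ('v set \<Rightarrow> 'f) set)"
    using finite_basis_cycles[OF X] by metis
  have "chain.dim {0 :: 'v set \<Rightarrow> 'f} = 0"
    by (rule chain.dim_unique[of "{}"]) (auto simp: chain.independent_empty)
  then have "card T = 1"
    using betti T(5) boundaries_top[OF top, where 'f='f] by (simp add: reduced_betti_def)
  then obtain z where z: "T = {z}" by (rule card_1_singletonE)
  then have "z \<noteq> 0" "z \<in> cycles X i" "cycles X i \<subseteq> range (\<lambda>r. chain_scale r z)"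
    using T chain.span_singleton[of z] by auto
  then have "generates_cycles z X i"
    unfolding generates_cycles_def by blast
  then show ?thesis by (rule that)
qed

section \<open>Deleting one vertex\<close>

text \<open>In the exact sequence, \<open>lift\<close> says that
  \<open>H_{i+1}(X) -> H_i(link v)\<close> is onto; hence \<open>H_i(X - v)\<close> embeds into
  \<open>H_i(X) = 0\<close>.\<close>

lemma exact_at_deletion_relative:
  fixes X :: "'v complex"
  assumes X: "face_closed X" and exX: "exact_at (F :: 'f::field itself) X i"
    and lift: "\<And>b :: 'v set \<Rightarrow> 'f. b \<in> cycles (link X {v}) i \<Longrightarrow>
      \<exists>w\<in>cycles X (i + 1). b - contract v w \<in> boundaries (link X {v}) i"
  shows "exact_at F (induced X (- {v})) i"
  unfolding exact_at_def
proof
  let ?Y = "induced X (- {v})" and ?L = "link X {v}"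
  \<comment> \<open>The vertex \<open>v\<close> is inserted because it may fail to be a vertex of
    \<open>X\<close>, while \<open>bd_cone\<close> requires it in \<open>V\<close>.\<close>
  define V where "V = insert v (vertices X)"
  have V: "finite V" "v \<in> V" "vertices X \<subseteq> V"
    using finite_vertices[OF X] by (auto simp: V_def)
  have Y: "face_closed ?Y" and L: "face_closed ?L"
    using X by (auto intro: face_closed_induced face_closed_link)
  have VY: "vertices ?Y \<subseteq> V" and VL: "vertices ?L \<subseteq> V"
    using order_trans[OF vertices_mono[OF induced_subset] V(3)]
      order_trans[OF vertices_mono[OF link_subset[OF X]] V(3)] by simp_all
  note iffs = cycles_iff[OF X V(1,3)] boundaries_iff[OF X V(1,3)] cycles_iff[OF Y V(1) VY]
    boundaries_iff[OF Y V(1) VY] cycles_iff[OF L V(1) VL] boundaries_iff[OF L V(1) VL]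
  fix z :: "'v set \<Rightarrow> 'f" assume z: "z \<in> cycles ?Y i"
  then have "z \<in> chains ?Y i" by (simp add: cycles_def)
  then have "contract v z = 0"
    using chain_avoiding[OF Y _ vertex_notin_deletion] contract_avoiding by metis
  have "z \<in> boundaries X i"
    using z exX cycles_mono[OF Y X induced_subset] unfolding exact_at_def by blast
  then obtain c where c: "c \<in> chains X (i + 1)" "z = bd V c"
    by (auto simp: iffs)
  have "contract v c \<in> cycles ?L i"
    using contract_chain[OF X c(1), of v] contract_bd[of v V c] \<open>contract v z = 0\<close> c(2)
    by (simp add: iffs)
  then obtain w where w: "w \<in> cycles X (i + 1)" "contract v c - contract v w \<in> boundaries ?L i"
    using lift by blast
  then obtain g where g: "g \<in> chains ?L (i + 1)" "contract v c - contract v w = bd V g"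
    by (auto simp: iffs)
  have "w \<in> chains X (i + 1)" "bd V w = 0"
    using w(1) by (simp_all add: iffs)
  then have cw: "c - w \<in> chains X (i + 1)" "bd V (c - w) = z"
    using c by (simp_all add: bd_diff chains_diff)
  obtain a where a: "a \<in> chains ?Y (i + 1)" "c - w = a + cone v (contract v (c - w))"
    using decompose_chain[OF X cw(1)] by blast
  \<comment> \<open>The part of \<open>c - w\<close> through \<open>v\<close> is the cone over the
    boundary of \<open>g\<close>. Up to a boundary it equals \<open>g\<close>, which avoids
    \<open>v\<close>, so the filling of \<open>z\<close> can be pushed into the deletion.\<close>
  have "cone v (contract v (c - w)) = g - bd V (cone v g)"
    using bd_cone[OF V(1,2) chain_avoiding[OF L g(1) vertex_notin_link]] g(2)
    by (simp add: contract_diff)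
  then have "c - w = a + (g - bd V (cone v g))"
    using a(2) by simp
  then have "z = bd V (a + (g - bd V (cone v g)))"
    using cw(2) by simp
  then have "z = bd V (a + g)"
    by (simp add: bd_add bd_diff bd_bd)
  moreover have "a + g \<in> chains ?Y (i + 1)"
    using a(1) g(1) chains_mono[OF link_subset_deletion[OF X]] by (blast intro: chains_add)
  ultimately show "z \<in> boundaries ?Y i"
    unfolding iffs by blast
qed

lemma zero_in_cycles: "face_closed X \<Longrightarrow> 0 \<in> cycles X i"
  using subspace_cycles chain.subspace_0 by blast

lemma exact_at_deletion:
  fixes X :: "'v complex"
  assumes X: "face_closed X" and "exact_at (F :: 'f::field itself) X i" "exact_at F (link X {v}) i"
  shows "exact_at F (induced X (- {v})) i"
proof (rule exact_at_deletion_relative[OF assms(1,2)])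
  fix b :: "'v set \<Rightarrow> 'f" assume "b \<in> cycles (link X {v}) i"
  then show "\<exists>w\<in>cycles X (i + 1). b - contract v w \<in> boundaries (link X {v}) i"
    using assms(3) zero_in_cycles[OF X] unfolding exact_at_def by (intro bexI[of _ 0]) auto
qed

text \<open>The neighbouring part of the sequence: \<open>H_i(link v)\<close> lies between
  \<open>H_{i+1}(X) = 0\<close> and \<open>H_i(X - v) = 0\<close>.\<close>

lemma exact_at_link_if_deletion:
  fixes X :: "'v complex"
  assumes X: "face_closed X" and exX: "exact_at (F :: 'f::field itself) X (i + 1)"
    and exY: "exact_at F (induced X (- {v})) i"
  shows "exact_at F (link X {v}) i"
  unfolding exact_at_def
proof
  let ?Y = "induced X (- {v})" and ?L = "link X {v}"
  define V where "V = insert v (vertices X)"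
  have V: "finite V" "v \<in> V" "vertices X \<subseteq> V"
    using finite_vertices[OF X] by (auto simp: V_def)
  have Y: "face_closed ?Y" and L: "face_closed ?L"
    using X by (auto intro: face_closed_induced face_closed_link)
  have VY: "vertices ?Y \<subseteq> V" and VL: "vertices ?L \<subseteq> V"
    using order_trans[OF vertices_mono[OF induced_subset] V(3)]
      order_trans[OF vertices_mono[OF link_subset[OF X]] V(3)] by simp_all
  note iffs = cycles_iff[OF X V(1,3)] boundaries_iff[OF X V(1,3)] cycles_iff[OF Y V(1) VY]
    boundaries_iff[OF Y V(1) VY] cycles_iff[OF L V(1) VL] boundaries_iff[OF L V(1) VL]
  fix b :: "'v set \<Rightarrow> 'f" assume b: "b \<in> cycles ?L i"
  have bL: "b \<in> chains ?L i" "bd V b = 0" using b by (simp_all add: iffs)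
  have bv: "b \<in> avoiding v" by (rule chain_avoiding[OF L bL(1) vertex_notin_link])
  have "b \<in> boundaries ?Y i"
    using b exY cycles_mono[OF L Y link_subset_deletion[OF X]] unfolding exact_at_def by blast
  then obtain a where a: "a \<in> chains ?Y (i + 1)" "b = bd V a"
    by (auto simp: iffs)
  have av: "a \<in> avoiding v" by (rule chain_avoiding[OF Y a(1) vertex_notin_deletion])
  \<comment> \<open>The cycle \<open>b\<close> is filled twice, by \<open>a\<close> away from
    \<open>v\<close> and by its cone in the star of \<open>v\<close>. The two fillings glue to a
    cycle of \<open>X\<close>; contracting a filling of that cycle by \<open>v\<close> gives one of
    \<open>b\<close> inside the link.\<close>
  have "bd V (a - cone v b) = 0"
    using bd_cone[OF V(1,2) bv] bL(2) a(2) by (simp add: bd_diff)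
  moreover have "a - cone v b \<in> chains X (i + 1)"
    using a(1) chains_mono[OF induced_subset] cone_chain[OF X bL(1)] by (blast intro: chains_diff)
  ultimately have "a - cone v b \<in> boundaries X (i + 1)"
    using exX unfolding exact_at_def by (auto simp: iffs)
  then obtain c where c: "c \<in> chains X (i + 1 + 1)" "a - cone v b = bd V c"
    by (auto simp: iffs)
  have "- b = contract v (a - cone v b)"
    using av bv by (simp add: contract_diff contract_cone_self)
  also have "\<dots> = - bd V (contract v c)"
    by (simp add: c(2) contract_bd)
  finally have "b = bd V (contract v c)" by simp
  moreover have "contract v c \<in> chains ?L (i + 1)"
    using contract_chain[OF X c(1), of v] by (simp add: add.commute)
  ultimately show "b \<in> boundaries ?L i"
    unfolding iffs by blast
qed

section \<open>Complements of simplices and of missing faces\<close>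

text \<open>The void complex lacks even the generator in degree \<open>-1\<close>, unlike the
  \<open>(-1)\<close>-sphere \<open>{{}}\<close>.\<close>

lemma exact_at_empty: "exact_at (F :: 'f::field itself) ({} :: 'v complex) i"
proof -
  have "chains {} j = {0 :: 'v set \<Rightarrow> 'f}" for j
    by (auto simp: chains_def pointwise)
  then have "cycles {} i \<subseteq> {0 :: 'v set \<Rightarrow> 'f}"
    by (auto simp: cycles_def)
  then show ?thesis
    using subspace_boundaries[of "{}" i, THEN chain.subspace_0]
    by (auto simp: exact_at_def face_closed_def)
qed

lemma induced_Compl_empty [simp]: "induced X (- {}) = X"
  by (simp add: induced_def)

text \<open>Deletion of \<open>\<alpha>\<close> commutes with the link of \<open>v\<close>, and the
  link of \<open>\<tau>\<close> in the link of \<open>v\<close> is the link of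
  \<open>insert v \<tau>\<close>. So the hypothesis on links is inherited, and the induction covers
  both inputs of \<open>exact_at_deletion\<close>.\<close>

lemma exact_at_complement:
  fixes F :: "'f::field itself"
  assumes "finite \<alpha>" "face_closed X" "\<And>\<tau> i. \<tau> \<subseteq> \<alpha> \<Longrightarrow> exact_at F (link X \<tau>) i"
  shows "exact_at F (induced X (- \<alpha>)) i"
  using assms
proof (induction \<alpha> arbitrary: X i rule: finite_induct)
  case empty
  then show ?case by (metis induced_Compl_empty link_empty order_refl)
next
  case (insert v \<alpha> X i)
  have "exact_at F (induced X (- \<alpha>)) i"
    using insert.prems by (intro insert.IH) auto
  moreover have "exact_at F (link (induced X (- \<alpha>)) {v}) i"
    unfolding link_induced_Compl[OF insert.hyps(2)]
  proof (rule insert.IH[OF face_closed_link[OF insert.prems(1)]])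
    fix \<tau> i assume "\<tau> \<subseteq> \<alpha>"
    then show "exact_at F (link (link X {v}) \<tau>) i"
      using insert.hyps(2) insert.prems(2)[of "insert v \<tau>"] by (subst link_link) auto
  qed
  ultimately show ?case
    using exact_at_deletion[OF face_closed_induced[OF insert.prems(1)]]
    by (subst induced_Compl_insert)
qed

section \<open>Homology spheres in terms of exactness and fundamental cycles\<close>

definition sphere_like :: "'f::field itself \<Rightarrow> int \<Rightarrow> 'v complex \<Rightarrow> bool" where
  "sphere_like F m X \<longleftrightarrow>
     face_closed X \<and> {} \<in> X \<and> (\<forall>\<sigma>\<in>X. face_dim \<sigma> \<le> m) \<and>
     (\<forall>\<sigma>\<in>X. (\<forall>i. i \<noteq> m - face_dim \<sigma> - 1 \<longrightarrow> exact_at F (link X \<sigma>) i) \<and>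
       (\<exists>z :: 'v set \<Rightarrow> 'f. generates_cycles z (link X \<sigma>) (m - face_dim \<sigma> - 1)))"

lemma face_dim_empty [simp]: "face_dim {} = -1"
  by (simp add: face_dim_def)

lemma face_dim_Un: "finite \<sigma> \<Longrightarrow> finite \<tau> \<Longrightarrow> \<sigma> \<inter> \<tau> = {} \<Longrightarrow> face_dim (\<sigma> \<union> \<tau>) = face_dim \<sigma> + face_dim \<tau> + 1"
  by (simp add: face_dim_def card_Un_disjoint)

text \<open>The link of \<open>\<sigma>\<close> has no faces above dimension
  \<open>m - face_dim \<sigma> - 1\<close>, so its one nonzero Betti number sits in a degree without
  nonzero boundaries and yields a fundamental cycle.\<close>

lemma sphere_like_if_homology_sphere:
  fixes X :: "'v complex"
  assumes "homology_sphere (F :: 'f::field itself) m X"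
  shows "sphere_like F m X"
proof -
  have X: "face_closed X" "{} \<in> X"
    and sph: "\<And>\<sigma>. \<sigma> \<in> X \<Longrightarrow> sphere_homology F (m - face_dim \<sigma> - 1) (link X \<sigma>)"
    using assms by (auto simp: homology_sphere_def face_closed_simplicial)
  have dim: "face_dim \<sigma> \<le> m" if "\<sigma> \<in> X" for \<sigma>
    using assms that X(1) unfolding homology_sphere_def complex_dim_def face_closed_def
    by (metis Max_ge finite_imageI imageI)
  have "\<exists>z :: 'v set \<Rightarrow> 'f. generates_cycles z (link X \<sigma>) (m - face_dim \<sigma> - 1)" if \<sigma>: "\<sigma> \<in> X" for \<sigma>
  proof -
    have "face_dim \<tau> \<le> m - face_dim \<sigma> - 1" if "\<tau> \<in> link X \<sigma>" for \<tau>
    proof -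
      have "\<tau> \<inter> \<sigma> = {}" "\<tau> \<union> \<sigma> \<in> X" using that by (auto simp: link_def)
      then show ?thesis
        using dim[of "\<tau> \<union> \<sigma>"] face_dim_Un[of \<tau> \<sigma>] face_closed_finite[OF X(1)] by fastforce
    qed
    moreover have "reduced_betti TYPE('f) (link X \<sigma>) (m - face_dim \<sigma> - 1) = 1"
      using sph[OF \<sigma>] by (simp add: sphere_homology_def reduced_betti_def)
    ultimately show ?thesis
      using generates_cycles_if_betti_one[OF face_closed_link[OF X(1)]] by blast
  qed
  then show ?thesis
    using X dim sph exact_at_if_betti_zero[OF face_closed_link[OF X(1)], of F]
    unfolding sphere_like_def sphere_homology_def by auto
qed

lemma sphere_likeD:
  fixes X :: "'v complex"
  assumes "sphere_like (F :: 'f::field itself) m X"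
  shows "face_closed X" "{} \<in> X" "\<And>\<sigma>. \<sigma> \<in> X \<Longrightarrow> face_dim \<sigma> \<le> m"
    "\<And>i. i \<noteq> m \<Longrightarrow> exact_at F X i" "\<exists>z :: 'v set \<Rightarrow> 'f. generates_cycles z X m"
  using assms unfolding sphere_like_def by (force dest: bspec[of _ _ "{}"])+

lemma sphere_like_link:
  fixes F :: "'f::field itself" and X :: "'v complex"
  assumes X: "sphere_like F m X" and v: "{v} \<in> X"
  shows "sphere_like F (m - 1) (link X {v})"
proof -
  have fc: "face_closed X" using sphere_likeD[OF X] by blast
  have *: "insert v \<sigma> \<in> X" "link (link X {v}) \<sigma> = link X (insert v \<sigma>)"
    "face_dim (insert v \<sigma>) = face_dim \<sigma> + 1" if "\<sigma> \<in> link X {v}" for \<sigma>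
    using that face_closed_finite[OF fc, of "insert v \<sigma>"]
    by (auto simp: link_def face_dim_insert)
  have dim: "m - 1 - face_dim \<sigma> - 1 = m - face_dim (insert v \<sigma>) - 1" if "\<sigma> \<in> link X {v}" for \<sigma>
    using *(3)[OF that] by simp
  show ?thesis
    unfolding sphere_like_def
  proof (intro conjI ballI)
    show "{} \<in> link X {v}" using v by (simp add: link_def)
    fix \<sigma> assume \<sigma>: "\<sigma> \<in> link X {v}"
    show "face_dim \<sigma> \<le> m - 1"
      using sphere_likeD(3)[OF X *(1)[OF \<sigma>]] *(3)[OF \<sigma>] by simp
    show "\<forall>i. i \<noteq> m - 1 - face_dim \<sigma> - 1 \<longrightarrow> exact_at F (link (link X {v}) \<sigma>) i"
      "\<exists>z :: 'v set \<Rightarrow> 'f. generates_cycles z (link (link X {v}) \<sigma>) (m - 1 - face_dim \<sigma> - 1)"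
      using X *(1)[OF \<sigma>] unfolding sphere_like_def dim[OF \<sigma>] *(2)[OF \<sigma>] by blast+
  qed (rule face_closed_link[OF fc])
qed

lemma generates_cycles_unique:
  fixes x y z :: "'v set \<Rightarrow> 'f::field"
  assumes "generates_cycles z X i" "y \<in> cycles X i" "y \<noteq> 0" "x \<in> cycles X i"
  obtains r where "x = chain_scale r y"
proof -
  obtain a b where ab: "y = chain_scale a z" "x = chain_scale b z"
    using assms unfolding generates_cycles_def by blast
  then have "a \<noteq> 0" using assms(3) by auto
  then have "x = chain_scale (b / a) y"
    using ab by simp
  then show ?thesis by (rule that)
qed

section \<open>Connectedness and the support of the fundamental cycle\<close>

definition vertex_chain :: "'v \<Rightarrow> 'v set \<Rightarrow> 'f::field" where
  "vertex_chain v = (\<lambda>\<sigma>. if \<sigma> = {v} then 1 else 0)"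

lemma vertex_diff_cycle:
  fixes X :: "'v complex"
  assumes X: "face_closed X" and "{p} \<in> X" "{q} \<in> X"
  shows "vertex_chain p - vertex_chain q \<in> (cycles X 0 :: ('v set \<Rightarrow> 'f::field) set)"
proof -
  note V = finite_vertices[OF X]
  have "bd (vertices X) (vertex_chain v :: 'v set \<Rightarrow> 'f) = (\<lambda>\<tau>. if \<tau> = {} then 1 else 0)"
    if "{v} \<in> X" for v
  proof
    fix \<tau>
    have "contract u (vertex_chain v) \<tau> = (if u = v then if \<tau> = {} then 1 else 0 else 0 :: 'f)" for u
      by (auto simp: contract_def vertex_chain_def)
    then show "bd (vertices X) (vertex_chain v) \<tau> = (if \<tau> = {} then 1 else 0 :: 'f)"
      using that V by (auto simp: bd_def sum_fun_apply vertices_def)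
  qed
  then have "bd (vertices X) (vertex_chain p - vertex_chain q :: 'v set \<Rightarrow> 'f) = 0"
    using assms by (simp add: bd_diff)
  moreover have "vertex_chain v \<in> (chains X 0 :: ('v set \<Rightarrow> 'f) set)" if "{v} \<in> X" for v
    using that by (auto simp: chains_def vertex_chain_def face_dim_def)
  ultimately show ?thesis
    using assms cycles_iff[OF X V order_refl] chains_diff by blast
qed

text \<open>Connectedness of the edge graph as a propagation principle: a property that passes along
  edges and holds at one vertex holds at all.\<close>

lemma connected_if_exact_at_zero:
  fixes X :: "'v complex"
  assumes X: "face_closed X" and ex: "exact_at (F :: 'f::field itself) X 0"
    and p: "{p} \<in> X" and q: "{q} \<in> X" "q \<in> U"
    and step: "\<And>u w. u \<in> U \<Longrightarrow> u \<noteq> w \<Longrightarrow> {u, w} \<in> X \<Longrightarrow> w \<in> U"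
  shows "p \<in> U"
proof -
  let ?V = "vertices X"
  define U' where "U' = U \<inter> ?V"
  note V = finite_vertices[OF X]
  have U': "finite U'" "U' \<subseteq> ?V" using V by (auto simp: U'_def)
  have pq: "vertex_chain p - vertex_chain q \<in> (cycles X 0 :: ('v set \<Rightarrow> 'f) set)"
    by (rule vertex_diff_cycle[OF X p q(1)])
  obtain c :: "'v set \<Rightarrow> 'f" where c: "c \<in> chains X 1" "vertex_chain p - vertex_chain q = bd ?V c"
    using ex pq boundaries_iff[OF X V order_refl, of _ 0] unfolding exact_at_def by force
  \<comment> \<open>No edge leaves \<open>U\<close>, so the functional summing the coefficients over \<open>U\<close> kills boundaries.\<close>
  have "contract u (contract w c) {} = 0" if "u \<in> U'" "w \<in> ?V - U'" for u w
  proof (rule ccontr)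
    assume "contract u (contract w c) {} \<noteq> 0"
    then have "u \<noteq> w" "c {u, w} \<noteq> 0"
      by (auto simp: contract_def insert_commute split: if_splits)
    then show False
      using c(1) that step[of u w] by (auto simp: chains_def U'_def)
  qed
  then have "(\<Sum>w\<in>?V. contract u (contract w c) {}) = (\<Sum>w\<in>U'. contract u (contract w c) {})"
    if "u \<in> U'" for u
    using that V U'(2) by (intro sum.mono_neutral_right) auto
  \<comment> \<open>Evaluating \<open>bd U'\<close> at the empty face sums the coefficients over
    \<open>U'\<close>. With the inner sum also confined to \<open>U'\<close>, the value is a double
    boundary, hence zero.\<close>
  then have "bd U' (bd ?V c) {} = bd U' (bd U' c) {}"
    by (simp add: bd_def sum_fun_apply contract_sum)
  then have "bd U' (vertex_chain p - vertex_chain q :: 'v set \<Rightarrow> 'f) {} = 0"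
    by (simp add: c(2) bd_bd zero_fun_apply)
  moreover have "bd U' (vertex_chain v :: 'v set \<Rightarrow> 'f) {} = (if v \<in> U' then 1 else 0)" for v
    using U'(1) by (simp add: bd_def sum_fun_apply contract_def vertex_chain_def)
  ultimately have "p \<in> U'"
    using q by (auto simp: bd_diff minus_apply U'_def vertices_def split: if_splits)
  then show ?thesis by (simp add: U'_def)
qed

lemma cycle_zero_if_contracts_zero:
  assumes X: "face_closed X" and z: "z \<in> chains X i" and i: "i \<ge> 0"
    and con: "\<And>v. {v} \<in> X \<Longrightarrow> contract v z = 0"
  shows "z = 0"
proof (rule ccontr)
  assume "z \<noteq> 0"
  then obtain \<sigma> where \<sigma>: "z \<sigma> \<noteq> 0" by (auto simp: pointwise)
  then have "\<sigma> \<in> X" "face_dim \<sigma> = i" using z by (auto simp: chains_def)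
  then have "finite \<sigma>" "\<sigma> \<noteq> {}" using i X face_closed_finite by auto
  then obtain v where v: "v \<in> \<sigma>" by blast
  then have "contract v z (\<sigma> - {v}) \<noteq> 0"
    using \<sigma> \<open>finite \<sigma>\<close> by (simp add: contract_def insert_absorb)
  moreover have "{v} \<in> X"
    using face_closed_subset[OF X \<open>\<sigma> \<in> X\<close>] v by blast
  ultimately show False using con by (simp add: zero_fun_apply)
qed

text \<open>A vanishing contraction spreads along edges: if it vanishes at \<open>u\<close> and
  \<open>w\<close> is adjacent to \<open>u\<close>, then \<open>contract w z\<close> is a top cycle
  of the link of \<open>w\<close> whose contraction at \<open>u\<close> vanishes, so it is zero by
  induction. Connectedness then reaches every vertex. A \<open>0\<close>-sphere is not connected;
  there the one-dimensionality of the cycles takes over.\<close>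

lemma top_cycle_zero_if_contract_zero:
  fixes F :: "'f::field itself" and z :: "'v set \<Rightarrow> 'f"
  assumes "sphere_like F (int m) X" "{v} \<in> X" "z \<in> cycles X (int m)" "contract v z = 0"
  shows "z = 0"
  using assms
proof (induction m arbitrary: X v z)
  case 0
  note X = sphere_likeD[OF "0.prems"(1)]
  have z: "z \<in> chains X 0" using "0.prems"(3) by (simp add: cycles_def)
  have zv: "z {v} = 0"
    using fun_cong[OF "0.prems"(4), of "{}"] by (simp add: contract_def zero_fun_apply)
  show ?case
  proof (rule ccontr)
    assume nz: "z \<noteq> 0"
    then obtain p where p: "{p} \<in> X" "contract p z \<noteq> 0"
      using cycle_zero_if_contracts_zero[OF X(1) z] by auto
    then have "p \<noteq> v" using "0.prems"(4) by blast
    obtain y :: "'v set \<Rightarrow> 'f" where "generates_cycles y X 0" using X(5) by auto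
    \<comment> \<open>Every cycle is a multiple of \<open>z\<close>, whose coefficient at
      \<open>{v}\<close> is zero, whereas this difference has coefficient \<open>-1\<close>
      there.\<close>
    then obtain r where "vertex_chain p - vertex_chain v = chain_scale r z"
      using generates_cycles_unique[OF _ _ nz] "0.prems"(3)
        vertex_diff_cycle[OF X(1) p(1) "0.prems"(2)] by (metis of_nat_0)
    from fun_cong[OF this, of "{v}"] show False
      using zv \<open>p \<noteq> v\<close> by (simp add: vertex_chain_def chain_scale_def minus_apply)
  qed
next
  case (Suc m)
  note X = sphere_likeD[OF Suc.prems(1)]
  define U where "U = {u. contract u z = 0}"
  have step: "w \<in> U" if "u \<in> U" "u \<noteq> w" "{u, w} \<in> X" for u w
  proof -
    have w: "{w} \<in> X" using face_closed_subset[OF X(1) that(3)] by blast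
    have "sphere_like F (int m) (link X {w})"
      using sphere_like_link[OF Suc.prems(1) w] by simp
    moreover have "{u} \<in> link X {w}"
      using that by (simp add: link_def insert_commute)
    moreover have "contract w z \<in> cycles (link X {w}) (int m)"
      using contract_cycle[OF X(1) Suc.prems(3), of w] by simp
    moreover have "contract u (contract w z) = 0"
      using that(1) contract_anticommute[of u w z] by (simp add: U_def)
    ultimately show ?thesis using Suc.IH by (simp add: U_def)
  qed
  have "contract p z = 0" if "{p} \<in> X" for p
    using connected_if_exact_at_zero[OF X(1) X(4), of p v U] that Suc.prems(2,4) step
    by (auto simp: U_def)
  then show ?case
    using cycle_zero_if_contracts_zero[OF X(1), of z "int (Suc m)"] Suc.prems(3)
    by (simp add: cycles_def)
qed

section \<open>Complements of faces and missing faces in spheres\<close>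

lemma sphere_like_dim_nonneg: "sphere_like F m X \<Longrightarrow> {v} \<in> X \<Longrightarrow> 0 \<le> m"
  using sphere_likeD(3)[of F m X "{v}"] by (simp add: face_dim_def)

text \<open>Only two degrees are delicate. In degree \<open>m\<close>, a cycle avoiding
  \<open>v\<close> has contraction zero and so vanishes. In degree \<open>m - 1\<close>, the
  contraction of the fundamental cycle is nonzero, hence generates the top cycles of the link and
  makes the lifting hypothesis true.\<close>

lemma exact_at_sphere_minus_vertex:
  fixes X :: "'v complex"
  assumes S: "sphere_like (F :: 'f::field itself) m X" and v: "{v} \<in> X"
  shows "exact_at F (induced X (- {v})) i"
proof -
  let ?Y = "induced X (- {v})" and ?L = "link X {v}"
  note X = sphere_likeD[OF S] and L = sphere_likeD[OF sphere_like_link[OF S v]]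
  have fundamental: "z = 0" if "z \<in> cycles X m" "contract v z = 0" for z :: "'v set \<Rightarrow> 'f"
    using top_cycle_zero_if_contract_zero[of F "nat m"] S v that sphere_like_dim_nonneg[OF S v] by simp
  consider "i = m" | "i = m - 1" | "i \<noteq> m" "i \<noteq> m - 1" by blast
  then show ?thesis
  proof cases
    case 1
    have Y: "face_closed ?Y" using X(1) by (rule face_closed_induced)
    have "z = 0" if "z \<in> cycles ?Y m" for z :: "'v set \<Rightarrow> 'f"
    proof (rule fundamental)
      show "z \<in> cycles X m" using that cycles_mono[OF Y X(1) induced_subset] by blast
      have "z \<in> chains ?Y m" using that by (simp add: cycles_def)
      then show "contract v z = 0"
        using chain_avoiding[OF Y _ vertex_notin_deletion] contract_avoiding by metis
    qed
    then show ?thesis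
      using 1 chain.subspace_0[OF subspace_boundaries[OF Y]] by (auto simp: exact_at_def)
  next
    case 2
    obtain z y :: "'v set \<Rightarrow> 'f" where z: "generates_cycles z X m" and y: "generates_cycles y ?L (m - 1)"
      using X(5) L(5) by blast
    have cz: "contract v z \<in> cycles ?L (m - 1)" "contract v z \<noteq> 0"
      using z fundamental contract_cycle[OF X(1)] unfolding generates_cycles_def by blast+
    show ?thesis
      unfolding 2
    proof (rule exact_at_deletion_relative[OF X(1)])
      show "exact_at F X (m - 1)" by (rule X(4)) simp
      fix b :: "'v set \<Rightarrow> 'f" assume "b \<in> cycles ?L (m - 1)"
      then obtain r where "b = chain_scale r (contract v z)"
        using generates_cycles_unique[OF y cz] by blast
      then have "b - contract v (chain_scale r z) = 0"
        by (simp add: contract_scale)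
      moreover have "chain_scale r z \<in> cycles X (m - 1 + 1)"
        using z chain.subspace_scale[OF subspace_cycles[OF X(1)], of z m r]
        by (simp add: generates_cycles_def)
      ultimately show "\<exists>w\<in>cycles X (m - 1 + 1). b - contract v w \<in> boundaries ?L (m - 1)"
        using chain.subspace_0[OF subspace_boundaries[OF L(1)]] by metis
    qed
  next
    case 3
    then show ?thesis by (intro exact_at_deletion X L) auto
  qed
qed

text \<open>The induction starts at a single vertex because the sphere itself is not exact in degree
  \<open>m\<close>. Since \<open>\<tau>\<close> is a face of the link of \<open>v\<close> too, the
  induction hypothesis applies in the link, a sphere one dimension lower.\<close>

lemma exact_at_sphere_minus_face:
  fixes F :: "'f::field itself"
  assumes "finite \<tau>" "\<tau> \<noteq> {}" "sphere_like F m X" "\<tau> \<in> X"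
  shows "exact_at F (induced X (- \<tau>)) i"
  using assms
proof (induction \<tau> arbitrary: X m i rule: finite_ne_induct)
  case (singleton v)
  then show ?case by (intro exact_at_sphere_minus_vertex)
next
  case (insert v \<tau> X m i)
  note X = sphere_likeD[OF insert.prems(1)]
  have faces: "{v} \<in> X" "\<tau> \<in> X" "\<tau> \<in> link X {v}"
    using face_closed_subset[OF X(1) insert.prems(2)] insert.prems(2) insert.hyps(3)
    by (auto simp: link_def)
  have "exact_at F (induced X (- \<tau>)) i"
    using insert.IH insert.prems(1) faces(2) by blast
  moreover have "exact_at F (link (induced X (- \<tau>)) {v}) i"
    unfolding link_induced_Compl[OF insert.hyps(3)]
    using insert.IH sphere_like_link[OF insert.prems(1) faces(1)] faces(3) by blast
  ultimately show ?case
    using exact_at_deletion[OF face_closed_induced[OF X(1)]]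
    by (subst induced_Compl_insert)
qed

text \<open>The boundary of \<open>\<alpha>\<close> is an induced sphere of dimension \<open>card \<alpha> - 2\<close>; by Alexander duality
  its complement has homology in degree \<open>m - card \<alpha> + 1\<close>.\<close>

lemma not_exact_at_sphere_minus_missing_face:
  fixes F :: "'f::field itself" and X :: "'v complex"
  assumes "finite \<alpha>" "\<alpha> \<noteq> {}" "sphere_like F m X" "\<alpha> \<notin> X" "\<And>\<tau>. \<tau> \<subset> \<alpha> \<Longrightarrow> \<tau> \<in> X"
  shows "\<not> exact_at F (induced X (- \<alpha>)) (m - int (card \<alpha>) + 1)"
  using assms
proof (induction \<alpha> arbitrary: X m rule: finite_ne_induct)
  case (singleton v)
  note X = sphere_likeD[OF singleton.prems(1)]
  \<comment> \<open>The missing face is a single point outside the vertices of \<open>X\<close>, so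
    nothing is deleted and the fundamental class of \<open>X\<close> survives in degree
    \<open>m - 1 + 1 = m\<close>.\<close>
  have "induced X (- {v}) = X"
    using face_closed_subset[OF X(1), of _ "{v}"] singleton.prems(2) by (auto simp: induced_def)
  moreover have "boundaries X m = {0 :: 'v set \<Rightarrow> 'f}"
    using boundaries_top X(3) by blast
  ultimately show ?case
    using X(5) by (auto simp: exact_at_def generates_cycles_def)
next
  case (insert v \<alpha>)
  note X = sphere_likeD[OF insert.prems(1)]
  let ?i = "m - int (card (insert v \<alpha>)) + 1"
  have faces: "{v} \<in> X" "\<alpha> \<in> X" "\<alpha> \<notin> link X {v}"
    using insert.prems(2,3) insert.hyps by (auto simp: link_def)
  have "\<tau> \<in> link X {v}" if "\<tau> \<subset> \<alpha>" for \<tau>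
  proof -
    have "insert v \<tau> \<subset> insert v \<alpha>" "v \<notin> \<tau>" using that insert.hyps(3) by auto
    then show ?thesis using insert.prems(3) by (simp add: link_def)
  qed
  \<comment> \<open>Passing to the link lowers both the dimension of the sphere and the size of the
    missing face by one, so the degree stays \<open>?i\<close>. The nonzero class moves from there
    to \<open>X\<close> minus \<open>insert v \<alpha>\<close>, because \<open>X\<close> minus the
    face \<open>\<alpha>\<close> is exact in degree \<open>?i + 1\<close>.\<close>
  then have "\<not> exact_at F (induced (link X {v}) (- \<alpha>)) ?i"
    using insert.IH[OF sphere_like_link[OF insert.prems(1) faces(1)] faces(3)] insert.hyps
    by (simp add: algebra_simps)
  then show ?case
    using exact_at_link_if_deletion[OF face_closed_induced[OF X(1), of "- \<alpha>"], of F ?i v]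
      exact_at_sphere_minus_face[OF insert.hyps(1,2) insert.prems(1) faces(2)] insert.hyps(3)
    by (subst induced_Compl_insert) (auto simp: link_induced_Compl)
qed

section \<open>Stacked spheres, induced spheres and bistellar moves\<close>

lemma exact_at_subcomplex:
  fixes X :: "'v complex"
  assumes X: "face_closed X" and Y: "face_closed Y" and YX: "Y \<subseteq> X"
    and skel: "\<And>\<sigma>. \<sigma> \<in> X \<Longrightarrow> face_dim \<sigma> = i + 1 \<Longrightarrow> \<sigma> \<in> Y"
    and ex: "exact_at (F :: 'f::field itself) X i"
  shows "exact_at F Y i"
  unfolding exact_at_def
proof
  note V = finite_vertices[OF X]
  fix z :: "'v set \<Rightarrow> 'f" assume "z \<in> cycles Y i"
  then obtain c :: "'v set \<Rightarrow> 'f" where "c \<in> chains X (i + 1)" "z = bd (vertices X) c"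
    using ex cycles_mono[OF Y X YX] boundaries_iff[OF X V order_refl] unfolding exact_at_def by blast
  moreover from this have "c \<in> chains Y (i + 1)"
    using skel by (auto simp: chains_def)
  ultimately show "z \<in> boundaries Y i"
    using boundaries_iff[OF Y V vertices_mono[OF YX]] by blast
qed

lemma missing_face_of_stacked_sphere:
  assumes S: "stacked_sphere (F :: 'f::field itself) k d S"
    and \<alpha>: "finite \<alpha>" "\<alpha> \<noteq> {}" "\<alpha> \<notin> S" "\<And>\<tau>. \<tau> \<subset> \<alpha> \<Longrightarrow> \<tau> \<in> S"
  shows "\<not> (k + 2 \<le> int (card \<alpha>) \<and> int (card \<alpha>) \<le> d - k + 1)"
proof
  assume card: "k + 2 \<le> int (card \<alpha>) \<and> int (card \<alpha>) \<le> d - k + 1"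
  obtain B where "homology_ball F (d + 1) B" and SB: "S = ball_boundary F B"
    and stacked: "\<And>\<sigma>. \<sigma> \<in> B \<Longrightarrow> d + 1 - face_dim \<sigma> \<ge> k + 1 \<Longrightarrow> \<sigma> \<in> S"
    using S unfolding stacked_sphere_def stacked_ball_def by blast
  then have B: "face_closed B"
    by (simp add: homology_ball_def face_closed_simplicial)
  have sph: "sphere_like F d S"
    using S sphere_like_if_homology_sphere by (auto simp: stacked_sphere_def)
  \<comment> \<open>The upper bound gives \<open>face_dim \<alpha> \<le> d - k\<close>, so a face
    \<open>\<alpha>\<close> of \<open>B\<close> would lie in the boundary \<open>S\<close>.\<close>
  have "\<alpha> \<notin> B"
    using stacked[of \<alpha>] \<alpha>(3) card by (auto simp: face_dim_def)
  have "exact_at F (link B \<tau>) i" if "\<tau> \<subseteq> \<alpha>" for \<tau> i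
  proof (cases "\<tau> = \<alpha>")
    case True
    then show ?thesis using link_nonface[OF B \<open>\<alpha> \<notin> B\<close>] exact_at_empty by metis
  next
    case False
    then have "acyclic_complex F (link B \<tau>)"
      using that \<alpha>(4)[of \<tau>] by (auto simp: SB ball_boundary_def)
    then show ?thesis
      using exact_at_if_betti_zero[OF face_closed_link[OF B], of F] by (simp add: acyclic_complex_def)
  qed
  then have "exact_at F (induced B (- \<alpha>)) (d - int (card \<alpha>) + 1)"
    using exact_at_complement[OF \<alpha>(1) B] by blast
  then have "exact_at F (induced S (- \<alpha>)) (d - int (card \<alpha>) + 1)"
  proof (rule exact_at_subcomplex[rotated 4])
    show "induced S (- \<alpha>) \<subseteq> induced B (- \<alpha>)"
      by (auto simp: SB ball_boundary_def induced_def)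
    \<comment> \<open>The lower bound gives \<open>d - card \<alpha> + 2 \<le> d - k\<close>, so
      stackedness puts the faces carrying the filling into \<open>S\<close>.\<close>
    show "\<sigma> \<in> induced S (- \<alpha>)"
      if "\<sigma> \<in> induced B (- \<alpha>)" "face_dim \<sigma> = d - int (card \<alpha>) + 1 + 1" for \<sigma>
      using that stacked[of \<sigma>] card by (auto simp: induced_def)
  qed (use B sphere_likeD(1)[OF sph] in \<open>auto intro: face_closed_induced\<close>)
  then show False
    using not_exact_at_sphere_minus_missing_face[OF \<alpha>(1,2) sph \<alpha>(3,4)] by blast
qed

text \<open>With at least two elements, every singleton of \<open>\<alpha>\<close> is a proper face,
  which forces \<open>\<alpha> \<subseteq> W\<close>; otherwise \<open>\<alpha>\<close> could be a
  face of \<open>S\<close> that \<open>W\<close> fails to contain.\<close>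

lemma missing_face_if_induced_boundary:
  assumes ind: "induced S W = simplex_boundary \<alpha>" and card: "card \<alpha> \<ge> 2"
  shows "\<alpha> \<notin> S" "\<tau> \<subset> \<alpha> \<Longrightarrow> \<tau> \<in> S"
proof -
  have "{x} \<subset> \<alpha>" if "x \<in> \<alpha>" for x
    using that card by (cases "\<alpha> = {x}") auto
  then have "{x} \<in> induced S W" if "x \<in> \<alpha>" for x
    using that unfolding ind simplex_boundary_def by blast
  then have "\<alpha> \<subseteq> W"
    unfolding induced_def by blast
  then show "\<alpha> \<notin> S"
    using ind by (auto simp: simplex_boundary_def induced_def)
  show "\<tau> \<in> S" if "\<tau> \<subset> \<alpha>"
    using that ind by (auto simp: simplex_boundary_def induced_def)
qed

text \<open>Restricting the join to \<open>\<beta>\<close> leaves only the empty face of the factor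
  on \<open>\<alpha>\<close>. Thus a move of index \<open>i\<close> exhibits an induced standard
  sphere of dimension \<open>i - 1\<close>.\<close>

lemma induced_bistellar_boundary:
  assumes "admits_bistellar_move X \<alpha> \<beta>"
  shows "induced X \<beta> = simplex_boundary \<beta>"
proof -
  have ind: "induced X (\<alpha> \<union> \<beta>) = join (full_simplex \<alpha>) (simplex_boundary \<beta>)" and "\<alpha> \<inter> \<beta> = {}"
    using assms by (auto simp: admits_bistellar_move_def)
  have "induced X \<beta> = {\<sigma> \<in> induced X (\<alpha> \<union> \<beta>). \<sigma> \<subseteq> \<beta>}"
    by (auto simp: induced_def)
  also have "\<dots> = simplex_boundary \<beta>"
  proof (intro equalityI subsetI)
    fix \<sigma> assume "\<sigma> \<in> {\<sigma> \<in> induced X (\<alpha> \<union> \<beta>). \<sigma> \<subseteq> \<beta>}"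
    then obtain \<rho> \<tau> where "\<sigma> = \<rho> \<union> \<tau>" "\<rho> \<subseteq> \<alpha>" "\<tau> \<subset> \<beta>" "\<sigma> \<subseteq> \<beta>"
      unfolding ind join_def full_simplex_def simplex_boundary_def by blast
    then have "\<sigma> = \<tau>" using \<open>\<alpha> \<inter> \<beta> = {}\<close> by blast
    then show "\<sigma> \<in> simplex_boundary \<beta>"
      using \<open>\<tau> \<subset> \<beta>\<close> by (simp add: simplex_boundary_def)
  next
    fix \<sigma> assume "\<sigma> \<in> simplex_boundary \<beta>"
    then show "\<sigma> \<in> {\<sigma> \<in> induced X (\<alpha> \<union> \<beta>). \<sigma> \<subseteq> \<beta>}"
      unfolding ind join_def full_simplex_def by (force simp: simplex_boundary_def)
  qed
  finally show ?thesis .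
qed

theorem corollary2p13:
  fixes S :: "'v complex" and k d :: int
  assumes "k \<ge> 0"
    and "stacked_sphere TYPE('f::field) k d S"
  shows "(\<forall>e. k \<le> e \<and> e \<le> d - k - 1 \<longrightarrow>
            \<not> (\<exists>W. W \<subseteq> vertices S \<and> standard_sphere e (induced S W))) \<and>
         (\<forall>i. k + 1 \<le> i \<and> i \<le> d - k \<longrightarrow>
            \<not> (\<exists>\<alpha> \<beta>. admits_bistellar_move S \<alpha> \<beta> \<and> bistellar_index \<alpha> \<beta> = i))"
proof -
  \<comment> \<open>An \<open>e\<close>-sphere has \<open>card \<alpha> = e + 2\<close> and a move
    of index \<open>i\<close> has \<open>card \<beta> = i + 1\<close>, so both ranges in the theorem
    become the one stated here.\<close>
  have no_induced: False
    if "induced S W = simplex_boundary \<alpha>" "finite \<alpha>" "k + 2 \<le> int (card \<alpha>)" "int (card \<alpha>) \<le> d - k + 1"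
    for W \<alpha>
  proof -
    have "card \<alpha> \<ge> 2" using that(3) assms(1) by linarith
    moreover from this have "\<alpha> \<noteq> {}" by auto
    ultimately show False
      using missing_face_of_stacked_sphere[OF assms(2) that(2), OF _ missing_face_if_induced_boundary[OF that(1)]]
        that(3,4) by blast
  qed
  show ?thesis
  proof (intro conjI allI impI notI)
    fix e assume "k \<le> e \<and> e \<le> d - k - 1" "\<exists>W. W \<subseteq> vertices S \<and> standard_sphere e (induced S W)"
    then show False
      using no_induced by (force simp: standard_sphere_def)
  next
    fix i assume i: "k + 1 \<le> i \<and> i \<le> d - k"
      and "\<exists>\<alpha> \<beta>. admits_bistellar_move S \<alpha> \<beta> \<and> bistellar_index \<alpha> \<beta> = i"
    then obtain \<alpha> \<beta> where move: "admits_bistellar_move S \<alpha> \<beta>" and "int (card \<beta>) = i + 1"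
      by (auto simp: bistellar_index_def face_dim_def)
    moreover have "finite \<beta>" using move by (simp add: admits_bistellar_move_def)
    ultimately show False
      using no_induced[OF induced_bistellar_boundary[OF move]] i by auto
  qed
qed

end
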